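(* Let $(\mathcal X^n)_{n\ge 1}$ be a large market as described in the context, with numéraire portfolios $V^n\in\mathcal X^n_1$ and sets $\mathcal D^n$ of equivalent supermartingale densities. The following conditions are equivalent: (a) NAA (there is no asymptotic arbitrage on $(\mathcal X^n)$); (b) $\lim_{\alpha\downarrow 0}\liminf_{n\to\infty}\mathsf E_{\mathsf P^n} (V^n_T)^{-\alpha}=1$; (c) there exists a sequence $Z^n\in\mathcal D^n$ such that $\lim_{\alpha\downarrow 0}\liminf_{n\to\infty}\mathsf E_{\mathsf P^n} (Z^n_T)^\alpha=1$.
   Context: Setting. For each $n\ge1$, $(\Omega^n,\mathcal F^n_T,\mathsf P^n)$ is a probability space with a filtration $\mathbb F^n=(\mathcal F^n_t)_{t\in\mathbb T^n}$, where $\mathbb T^n$ is an interval $[0,T(n)]$ or a set of integers $\{0,\dots,T(n)\}$; the $\sigma$-algebra $\mathcal F^n_0$ is trivial up to $\mathsf P^n$-null sets. A subscript $T$ on an object of the $n$-th market means $T(n)$ (so $\mathcal F^n_T=\mathcal F^n_{T(n)}$, $X^n_T=X^n_{T(n)}$). $\mathcal X^n$ is a family of non-negative $\mathbb F^n$-adapted processes such that: (i) $1\in\mathcal X^n$, and $X\in\mathcal X^n$, $\lambda>0$ imply $\lambda X\in\mathcal X^n$; (ii) there is a strictly positive process (numéraire portfolio) $V^n\in\mathcal X^n_1=\{X^n\in\mathcal X^n: X^n_0=1\}$ such that $X^n/V^n$ is a $\mathsf P^n$-supermartingale for all $X^n\in\mathcal X^n$. The large market is the sequence $(\mathcal X^n)_{n\ge1}$.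 NAA (no asymptotic arbitrage): for any sequence $X^n\in\mathcal X^n$, $X^n_0\to0$ implies $\limsup_{n\to\infty}\mathsf P^n(X^n_T\ge1)=0$. $\mathcal D^n$ is the set of equivalent supermartingale densities: strictly positive $\mathbb F^n$-adapted processes $Z^n$ with $Z^n_0=1$ such that $X^nZ^n$ is a $\mathsf P^n$-supermartingale for all $X^n\in\mathcal X^n$. *)

theory Defs
  imports "HOL-Probability.Probability"
begin

text \<open>
  Time is real-valued; a process is a map from times to functions on the sample space, and only
  its values at times in \<open>I\<close> matter.  Relations between random variables are understood up to null
  sets; relations between processes hold, outside a single null set, at all times in \<open>I\<close>.
\<close>

type_synonym 'a process = "real \<Rightarrow> 'a \<Rightarrow> real"

definition time_set :: "real \<Rightarrow> real set \<Rightarrow> bool" where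
  "time_set T I \<longleftrightarrow> 0 \<le> T \<and> (I = {0..T} \<or> T \<in> \<int> \<and> I = {0..T} \<inter> \<int>)"

text \<open>
  The library's locale \<open>filtration\<close> is indexed by a whole type, whereas here the index set \<open>I\<close>
  varies with the market.
\<close>

locale filtered_prob_space = prob_space M
  for M :: "'a measure" +
  fixes T :: real and I :: "real set" and F :: "real \<Rightarrow> 'a measure"
  assumes time_set: "time_set T I"
    and subalgebra: "t \<in> I \<Longrightarrow> subalgebra M (F t)"
    and mono: "s \<in> I \<Longrightarrow> t \<in> I \<Longrightarrow> s \<le> t \<Longrightarrow> sets (F s) \<subseteq> sets (F t)"
    and terminal: "sets (F T) = sets M"
    and trivial: "A \<in> sets (F 0) \<Longrightarrow> measure M A = 0 \<or> measure M A = 1"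

definition adapted :: "real set \<Rightarrow> (real \<Rightarrow> 'a measure) \<Rightarrow> 'a process \<Rightarrow> bool" where
  "adapted I F X \<longleftrightarrow> (\<forall>t\<in>I. X t \<in> borel_measurable (F t))"

definition nonneg_process :: "'a measure \<Rightarrow> real set \<Rightarrow> 'a process \<Rightarrow> bool" where
  "nonneg_process M I X \<longleftrightarrow> (AE \<omega> in M. \<forall>t\<in>I. 0 \<le> X t \<omega>)"

definition strictly_pos_process :: "'a measure \<Rightarrow> real set \<Rightarrow> 'a process \<Rightarrow> bool" where
  "strictly_pos_process M I X \<longleftrightarrow> (AE \<omega> in M. \<forall>t\<in>I. 0 < X t \<omega>)"

definition supermartingale ::
    "'a measure \<Rightarrow> real set \<Rightarrow> (real \<Rightarrow> 'a measure) \<Rightarrow> 'a process \<Rightarrow> bool" where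
  "supermartingale M I F X \<longleftrightarrow>
     adapted I F X \<and> (\<forall>t\<in>I. integrable M (X t)) \<and>
     (\<forall>s\<in>I. \<forall>t\<in>I. s \<le> t \<longrightarrow> (AE \<omega> in M. real_cond_exp M (F s) (X t) \<omega> \<le> X s \<omega>))"

locale market = filtered_prob_space M T I F
  for M :: "'a measure" and T I F +
  fixes XX :: "'a process set"
  assumes adapted: "X \<in> XX \<Longrightarrow> adapted I F X"
    and nonneg: "X \<in> XX \<Longrightarrow> nonneg_process M I X"
    and one: "(\<lambda>t \<omega>. 1) \<in> XX"
    and scale: "X \<in> XX \<Longrightarrow> 0 < l \<Longrightarrow> (\<lambda>t \<omega>. l * X t \<omega>) \<in> XX"

definition unit_start :: "'a measure \<Rightarrow> 'a process set \<Rightarrow> 'a process set" where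
  "unit_start M XX = {X \<in> XX. AE \<omega> in M. X 0 \<omega> = 1}"

definition numeraire_portfolio ::
    "'a measure \<Rightarrow> real set \<Rightarrow> (real \<Rightarrow> 'a measure) \<Rightarrow> 'a process set \<Rightarrow> 'a process \<Rightarrow> bool" where
  "numeraire_portfolio M I F XX V \<longleftrightarrow>
     V \<in> unit_start M XX \<and> strictly_pos_process M I V \<and>
     (\<forall>X\<in>XX. supermartingale M I F (\<lambda>t \<omega>. X t \<omega> / V t \<omega>))"

definition supermartingale_densities ::
    "'a measure \<Rightarrow> real set \<Rightarrow> (real \<Rightarrow> 'a measure) \<Rightarrow> 'a process set \<Rightarrow> 'a process set" where
  "supermartingale_densities M I F XX =
     {Z. adapted I F Z \<and> strictly_pos_process M I Z \<and> (AE \<omega> in M. Z 0 \<omega> = 1) \<and>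
         (\<forall>X\<in>XX. supermartingale M I F (\<lambda>t \<omega>. X t \<omega> * Z t \<omega>))}"

text \<open>
  The initial value of a process in \<open>XX n\<close> is almost surely constant because \<open>F n 0\<close> is trivial;
  \<open>x n\<close> is that constant.
\<close>

definition NAA ::
    "(nat \<Rightarrow> 'a measure) \<Rightarrow> (nat \<Rightarrow> real) \<Rightarrow> (nat \<Rightarrow> 'a process set) \<Rightarrow> bool" where
  "NAA M T XX \<longleftrightarrow>
     (\<forall>X x. (\<forall>n\<ge>1. X n \<in> XX n \<and> (AE \<omega> in M n. X n 0 \<omega> = x n)) \<longrightarrow> x \<longlonglongrightarrow> 0 \<longrightarrow>
        limsup (\<lambda>n. ereal (measure (M n) {\<omega> \<in> space (M n). 1 \<le> X n (T n) \<omega>})) = 0)"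

end

theory Submission imports Defs begin

text \<open>
  All three conditions say that no mass of the terminal value of a density escapes to zero: for every
  \<open>\<delta> > 0\<close> there is an \<open>\<epsilon> > 0\<close> such that \<open>P\<^sup>n(Z\<^sup>n\<^sub>T < \<epsilon>) \<le> \<delta>\<close> for all large \<open>n\<close>.  This property is
  called \<open>asymptotically_positive\<close> below; for \<open>Z\<^sup>n = 1 / V\<^sup>n\<close> it is tightness of the terminal values
  of the numeraire portfolios.

  Terminal values of densities have mean at most one, and this makes asymptotic positivity equivalent
  to the moment condition (\<open>moments_tendsto_one_iff_asymptotically_positive\<close>).  Indeed the weighted
  inequality \<open>z\<^sup>\<alpha> \<le> \<alpha> z + (1 - \<alpha>)\<close> shows, for \<open>0 < \<alpha> < 1\<close>, that the \<open>\<alpha>\<close>-moment is at most one, and that a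
  moment close to one leaves no room for small values of \<open>Z\<close>.  Conversely, if \<open>Z \<ge> \<epsilon>\<close> with
  probability at least \<open>1 - \<delta>\<close>, then the moment is at least \<open>\<epsilon>\<^sup>\<alpha> (1 - \<delta>)\<close>, which tends to \<open>1 - \<delta>\<close>.

  The link with arbitrage has two halves.  If some sequence of densities is asymptotically
  positive, then \<open>E X\<^sub>T Z\<^sub>T \<le> X\<^sub>0\<close> and Markov's inequality show that a vanishing initial capital
  cannot produce \<open>X\<^sub>T \<ge> 1\<close> except where \<open>Z\<^sub>T\<close> is small (\<open>asymptotically_positive_density_imp_NAA\<close>).
  If the terminal values \<open>V\<^sup>n\<^sub>T\<close> are not tight, then suitably shrunk numeraire
  portfolios are themselves an asymptotic arbitrage (\<open>NAA_imp_inverse_numeraire_asymptotically_positive\<close>).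
  Since \<open>1 / V\<^sup>n\<close> is a density, the circle closes.
\<close>

section \<open>Moments of small order and small values\<close>

lemma powr_le_convex_combination:
  fixes z a :: real
  assumes "0 < z" "0 < a" "a < 1"
  shows "z powr a \<le> a * z + (1 - a)"
  using Youngs_inequality_0[of a "1 - a" z 1] assms by simp

context prob_space
begin

lemma integrable_powr:
  fixes Z :: "'a \<Rightarrow> real" and a :: real
  assumes "integrable M Z" "AE \<omega> in M. 0 < Z \<omega>" "0 < a" "a < 1"
  shows "integrable M (\<lambda>\<omega>. Z \<omega> powr a)"
proof (rule Bochner_Integration.integrable_bound)
  have [measurable]: "Z \<in> borel_measurable M"
    using assms(1) by auto
  show "integrable M (\<lambda>\<omega>. a * Z \<omega> + (1 - a))"
    using assms(1) by simp
  show "(\<lambda>\<omega>. Z \<omega> powr a) \<in> borel_measurable M"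
    by measurable
  show "AE \<omega> in M. norm (Z \<omega> powr a) \<le> norm (a * Z \<omega> + (1 - a))"
    using assms(2)
  proof eventually_elim
    case (elim \<omega>)
    then show ?case
      using powr_le_convex_combination[of "Z \<omega>" a] assms(3,4) by simp
  qed
qed

lemma expectation_powr_le_one:
  fixes Z :: "'a \<Rightarrow> real" and a :: real
  assumes "integrable M Z" "AE \<omega> in M. 0 < Z \<omega>" "expectation Z \<le> 1" "0 < a" "a < 1"
  shows "expectation (\<lambda>\<omega>. Z \<omega> powr a) \<le> 1"
proof -
  have "expectation (\<lambda>\<omega>. Z \<omega> powr a) \<le> expectation (\<lambda>\<omega>. a * Z \<omega> + (1 - a))"
  proof (rule integral_mono_AE)
    show "AE \<omega> in M. Z \<omega> powr a \<le> a * Z \<omega> + (1 - a)"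
      using assms(2) by eventually_elim (use powr_le_convex_combination assms(4,5) in auto)
  qed (use assms integrable_powr in auto)
  also have "\<dots> = a * expectation Z + (1 - a)"
    using assms(1) by (simp add: prob_space)
  also have "\<dots> \<le> 1"
    using mult_left_mono[OF assms(3), of a] assms(4) by simp
  finally show ?thesis .
qed

text \<open>
  Where \<open>Z < \<epsilon>\<close>, the bound \<open>\<alpha> Z + (1 - \<alpha>)\<close> on \<open>Z\<^sup>\<alpha>\<close> can be replaced by \<open>\<epsilon>\<^sup>\<alpha>\<close>; this saves
  \<open>1 - \<alpha>\<close> per unit of mass, so a moment near one forces that mass to be small.
\<close>

lemma prob_small_le_moment_deficit:
  fixes Z :: "'a \<Rightarrow> real" and a :: real
  assumes "integrable M Z" "AE \<omega> in M. 0 < Z \<omega>" "expectation Z \<le> 1" "0 < a" "a < 1" "0 < e"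
  shows "(1 - a) * prob {\<omega> \<in> space M. Z \<omega> < e}
           \<le> 1 - expectation (\<lambda>\<omega>. Z \<omega> powr a) + e powr a"
proof -
  let ?A = "{\<omega> \<in> space M. Z \<omega> < e}"
  have [measurable]: "Z \<in> borel_measurable M"
    using assms(1) by auto
  have A: "?A \<in> sets M" by measurable
  have int_ind: "integrable M (indicator ?A :: 'a \<Rightarrow> real)"
    using A by (simp add: integrable_indicator_iff less_top[symmetric])
  have "expectation (\<lambda>\<omega>. Z \<omega> powr a) + (1 - a) * prob ?A
      = expectation (\<lambda>\<omega>. Z \<omega> powr a + (1 - a) * indicator ?A \<omega>)"
    using A int_ind integrable_powr[OF assms(1,2,4,5)] by (simp add: Int_absorb1)
  also have "\<dots> \<le> expectation (\<lambda>\<omega>. (e powr a + (1 - a)) + a * Z \<omega>)"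
  proof (rule integral_mono_AE)
    show "AE \<omega> in M. Z \<omega> powr a + (1 - a) * indicator ?A \<omega> \<le> (e powr a + (1 - a)) + a * Z \<omega>"
      using assms(2) AE_space
    proof eventually_elim
      case (elim \<omega>)
      show ?case
      proof (cases "Z \<omega> < e")
        case True
        then have "Z \<omega> powr a \<le> e powr a"
          using elim assms(4) by (intro powr_mono2) auto
        moreover have "0 \<le> a * Z \<omega>"
          using elim assms(4) by simp
        ultimately show ?thesis
          using True elim by simp
      next
        case False
        then have "indicator ?A \<omega> = (0::real)" by simp
        then show ?thesis
          using powr_le_convex_combination[OF elim(1) assms(4,5)] powr_ge_zero[of e a]
          by (simp only: mult_zero_right)
      qed
    qed
  qed (use int_ind integrable_powr[OF assms(1,2,4,5)] assms(1) in auto)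
  also have "\<dots> = e powr a + (1 - a) + a * expectation Z"
    using assms(1) by (simp add: prob_space)
  also have "\<dots> \<le> e powr a + 1"
    using mult_left_mono[OF assms(3), of a] assms(4) by simp
  finally show ?thesis by simp
qed

lemma expectation_powr_ge:
  fixes Z :: "'a \<Rightarrow> real" and a :: real
  assumes "integrable M Z" "AE \<omega> in M. 0 < Z \<omega>" "0 < a" "a < 1" "0 < e"
  shows "e powr a * (1 - prob {\<omega> \<in> space M. Z \<omega> < e}) \<le> expectation (\<lambda>\<omega>. Z \<omega> powr a)"
proof -
  let ?A = "{\<omega> \<in> space M. Z \<omega> < e}"
  have [measurable]: "Z \<in> borel_measurable M"
    using assms(1) by auto
  have A: "?A \<in> sets M" by measurable
  have int_ind: "integrable M (indicator ?A :: 'a \<Rightarrow> real)"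
    using A by (simp add: integrable_indicator_iff less_top[symmetric])
  have "e powr a * (1 - prob ?A) = expectation (\<lambda>\<omega>. e powr a * (1 - indicator ?A \<omega>))"
    using A int_ind by (simp add: prob_space Int_absorb1)
  also have "\<dots> \<le> expectation (\<lambda>\<omega>. Z \<omega> powr a)"
  proof (rule integral_mono_AE)
    show "AE \<omega> in M. e powr a * (1 - indicator ?A \<omega>) \<le> Z \<omega> powr a"
      using assms(2) AE_space
    proof eventually_elim
      case (elim \<omega>)
      then show ?case
        using assms(3,5) powr_mono2[of a e "Z \<omega>"] by (cases "Z \<omega> < e") auto
    qed
  qed (use int_ind integrable_powr[OF assms(1,2,3,4)] in auto)
  finally show ?thesis .
qed

end

section \<open>Asymptotic positivity\<close>

definition asymptotically_positive :: "(nat \<Rightarrow> 'a measure) \<Rightarrow> (nat \<Rightarrow> 'a \<Rightarrow> real) \<Rightarrow> bool" where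
  "asymptotically_positive M Z \<longleftrightarrow>
     (\<forall>d>0. \<exists>e>0. \<forall>\<^sub>F n in sequentially. measure (M n) {\<omega> \<in> space (M n). Z n \<omega> < e} \<le> d)"

text \<open>
  The bound \<open>E Z\<^sup>n \<le> 1\<close> caps all moments of order less than one at one, so that only the lower
  bound matters for convergence.  For a given \<open>\<delta>\<close>, a single exponent \<open>\<alpha>\<close> with moments close enough to
  one yields a suitable \<open>\<epsilon>\<close>; conversely, once \<open>\<epsilon>\<close> is fixed, \<open>\<epsilon>\<^sup>\<alpha>\<close> tends to one as \<open>\<alpha> \<down> 0\<close>.
\<close>

lemma moments_tendsto_one_iff_asymptotically_positive:
  fixes M :: "nat \<Rightarrow> 'a measure" and Z :: "nat \<Rightarrow> 'a \<Rightarrow> real"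
  assumes prob: "\<And>n. n \<ge> 1 \<Longrightarrow> prob_space (M n)"
    and int: "\<And>n. n \<ge> 1 \<Longrightarrow> integrable (M n) (Z n)"
    and pos: "\<And>n. n \<ge> 1 \<Longrightarrow> AE \<omega> in M n. 0 < Z n \<omega>"
    and mean: "\<And>n. n \<ge> 1 \<Longrightarrow> (\<integral>\<omega>. Z n \<omega> \<partial>M n) \<le> 1"
  shows "((\<lambda>a. liminf (\<lambda>n. \<integral>\<^sup>+ \<omega>. ennreal (Z n \<omega> powr a) \<partial>M n)) \<longlongrightarrow> 1) (at_right 0)
           \<longleftrightarrow> asymptotically_positive M Z"
    (is "(?f \<longlongrightarrow> 1) (at_right 0) \<longleftrightarrow> _")
proof
  define m where "m a n = (\<integral>\<omega>. Z n \<omega> powr a \<partial>M n)" for a n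
  have nn: "(\<integral>\<^sup>+ \<omega>. ennreal (Z n \<omega> powr a) \<partial>M n) = ennreal (m a n)"
    if "n \<ge> 1" "0 < a" "a < 1" for a n
    unfolding m_def
    using prob_space.integrable_powr[OF prob int pos] that by (intro nn_integral_eq_integral) auto
  have small: "\<forall>\<^sub>F a in at_right 0. 0 < a \<and> a < b" if "0 < b" for b :: real
    using eventually_at_right_real[OF that] by (rule eventually_mono) auto
  show "asymptotically_positive M Z" if lim: "(?f \<longlongrightarrow> 1) (at_right 0)"
    unfolding asymptotically_positive_def
  proof (intro allI impI)
    fix d :: real
    assume d: "0 < d"
    have "ennreal (1 - d/4) < 1"
      using d ennreal_lessI[of 1 "1 - d/4"] by simp
    then have "\<forall>\<^sub>F a in at_right 0. ennreal (1 - d/4) < ?f a"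
      using order_tendstoD(1)[OF lim] by blast
    then have "\<forall>\<^sub>F a in at_right 0. ennreal (1 - d/4) < ?f a \<and> 0 < a \<and> a < 1/2"
      using small[OF half_gt_zero[OF zero_less_one]] by eventually_elim auto
    then obtain a where a: "ennreal (1 - d/4) < ?f a" "0 < a" "a < 1/2"
      using eventually_happens'[OF trivial_limit_at_right_real] by blast
    \<comment> \<open>This makes \<open>e powr a = d/4\<close>, a share of \<open>d\<close> equal to that of the moment deficit.\<close>
    define e where "e = (d/4) powr (1/a)"
    have e: "0 < e" "e powr a = d/4"
      using d a by (auto simp: e_def powr_powr)
    have "\<forall>\<^sub>F n in sequentially. measure (M n) {\<omega> \<in> space (M n). Z n \<omega> < e} \<le> d"
      using less_LiminfD[OF a(1)] eventually_ge_at_top[of 1]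
    proof eventually_elim
      case (elim n)
      let ?p = "measure (M n) {\<omega> \<in> space (M n). Z n \<omega> < e}"
      have "ennreal (1 - d/4) < ennreal (m a n)"
        using elim nn[of n a] a(2,3) by simp
      then have "1 - d/4 < m a n"
        using ennreal_leI[of "m a n" "1 - d/4"] by (auto simp: not_less[symmetric])
      moreover have "(1 - a) * ?p \<le> 1 - m a n + e powr a"
        unfolding m_def
        using elim(2) a(2,3) e(1)
        by (intro prob_space.prob_small_le_moment_deficit prob int pos mean) auto
      moreover have "1/2 * ?p \<le> (1 - a) * ?p"
        using a by (intro mult_right_mono) auto
      ultimately show ?case
        using e by simp
    qed
    then show "\<exists>e>0. \<forall>\<^sub>F n in sequentially. measure (M n) {\<omega> \<in> space (M n). Z n \<omega> < e} \<le> d"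
      using e by blast
  qed
  show "(?f \<longlongrightarrow> 1) (at_right 0)" if tight: "asymptotically_positive M Z"
  proof (rule order_tendstoI)
    fix y :: ennreal
    assume y: "1 < y"
    show "\<forall>\<^sub>F a in at_right 0. ?f a < y"
      using small[OF zero_less_one]
    proof eventually_elim
      case (elim a)
      have "\<forall>\<^sub>F n in sequentially. (\<integral>\<^sup>+ \<omega>. ennreal (Z n \<omega> powr a) \<partial>M n) \<le> 1"
        using eventually_ge_at_top[of 1]
      proof eventually_elim
        case (elim n)
        have "m a n \<le> 1"
          unfolding m_def
          using elim \<open>0 < a \<and> a < 1\<close>
          by (intro prob_space.expectation_powr_le_one prob int pos mean) auto
        then show ?case
          using nn[of n a] elim \<open>0 < a \<and> a < 1\<close> ennreal_leI[of "m a n" 1] by simp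
      qed
      then have "?f a \<le> 1"
        by (intro Liminf_le) auto
      then show ?case
        using y by simp
    qed
  next
    fix y :: ennreal
    assume y: "y < 1"
    then obtain r where r: "y = ennreal r" "0 \<le> r" "r < 1"
      by (cases y) (auto simp flip: ennreal_1 simp: ennreal_less_iff)
    define d where "d = (1 - r)/4"
    have d: "0 < d" "d < 1" using r by (auto simp: d_def)
    then obtain e where e: "0 < e"
      and ev: "\<forall>\<^sub>F n in sequentially. measure (M n) {\<omega> \<in> space (M n). Z n \<omega> < e} \<le> d"
      using tight unfolding asymptotically_positive_def by blast
    have "((\<lambda>a. e powr a * (1 - d)) \<longlongrightarrow> e powr 0 * (1 - d)) (at_right 0)"
      using e by (intro tendsto_intros) auto
    moreover have "(1 + r)/2 < e powr 0 * (1 - d)"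
      using e r by (simp add: d_def field_simps)
    ultimately have "\<forall>\<^sub>F a in at_right 0. (1 + r)/2 < e powr a * (1 - d)"
      by (rule order_tendstoD(1))
    then show "\<forall>\<^sub>F a in at_right 0. y < ?f a"
      using small[OF zero_less_one]
    proof eventually_elim
      case (elim a)
      have "\<forall>\<^sub>F n in sequentially. ennreal ((1 + r)/2) \<le> (\<integral>\<^sup>+ \<omega>. ennreal (Z n \<omega> powr a) \<partial>M n)"
        using ev eventually_ge_at_top[of 1]
      proof eventually_elim
        case (elim n)
        let ?p = "measure (M n) {\<omega> \<in> space (M n). Z n \<omega> < e}"
        have "e powr a * (1 - d) \<le> e powr a * (1 - ?p)"
          using elim by (intro mult_left_mono) auto
        also have "\<dots> \<le> m a n"
          unfolding m_def
          using elim(2) \<open>0 < a \<and> a < 1\<close> e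
          by (intro prob_space.expectation_powr_ge prob int pos) auto
        finally have "(1 + r)/2 \<le> m a n"
          using \<open>(1 + r)/2 < e powr a * (1 - d)\<close> by simp
        then show ?case
          using nn[of n a] elim \<open>0 < a \<and> a < 1\<close> ennreal_leI by simp
      qed
      then have "ennreal ((1 + r)/2) \<le> ?f a"
        by (rule Liminf_bounded)
      moreover have "y < ennreal ((1 + r)/2)"
        using r by (auto simp: ennreal_less_iff)
      ultimately show ?case by simp
    qed
  qed
qed

section \<open>Densities in a single market\<close>

context filtered_prob_space
begin

lemma zero_in_times: "0 \<in> I" and terminal_in_times: "T \<in> I" and horizon_nonneg: "0 \<le> T"
  using time_set unfolding time_set_def by auto

lemma adapted_terminal_measurable:
  assumes "adapted I F X"
  shows "X T \<in> borel_measurable M"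
  using assms terminal_in_times subalgebra[OF terminal_in_times]
  unfolding adapted_def by (auto intro: measurable_from_subalg)

lemma supermartingale_expectation_decreasing:
  assumes "supermartingale M I F X"
  shows "expectation (X T) \<le> expectation (X 0)"
proof -
  interpret finite_measure_subalgebra M "F 0"
    by (intro finite_measure_subalgebra.intro finite_measure_axioms
        finite_measure_subalgebra_axioms.intro subalgebra zero_in_times)
  have int: "integrable M (X T)" "integrable M (X 0)"
    and le: "AE \<omega> in M. real_cond_exp M (F 0) (X T) \<omega> \<le> X 0 \<omega>"
    using assms zero_in_times terminal_in_times horizon_nonneg unfolding supermartingale_def by auto
  have "expectation (X T) = expectation (real_cond_exp M (F 0) (X T))"
    using real_cond_exp_int[OF int(1)] by simp
  also have "\<dots> \<le> expectation (X 0)"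
    using int le by (intro integral_mono_AE real_cond_exp_int) auto
  finally show ?thesis .
qed

end

context market
begin

lemma density_strictly_pos_terminal:
  assumes "Z \<in> supermartingale_densities M I F XX"
  shows "AE \<omega> in M. 0 < Z T \<omega>"
proof -
  have "AE \<omega> in M. \<forall>t\<in>I. 0 < Z t \<omega>"
    using assms unfolding supermartingale_densities_def strictly_pos_process_def by blast
  then show ?thesis
    by eventually_elim (use terminal_in_times in auto)
qed

lemma deflated_terminal_bound:
  assumes Z: "Z \<in> supermartingale_densities M I F XX"
    and X: "X \<in> XX" and x: "AE \<omega> in M. X 0 \<omega> = x"
  shows "integrable M (\<lambda>\<omega>. X T \<omega> * Z T \<omega>)" "expectation (\<lambda>\<omega>. X T \<omega> * Z T \<omega>) \<le> x"
proof -
  have sm: "supermartingale M I F (\<lambda>t \<omega>. X t \<omega> * Z t \<omega>)" and Z0: "AE \<omega> in M. Z 0 \<omega> = 1"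
    using Z X unfolding supermartingale_densities_def by auto
  show "integrable M (\<lambda>\<omega>. X T \<omega> * Z T \<omega>)"
    using sm terminal_in_times unfolding supermartingale_def by auto
  have "integrable M (\<lambda>\<omega>. X 0 \<omega> * Z 0 \<omega>)"
    using sm zero_in_times unfolding supermartingale_def by auto
  then have "expectation (\<lambda>\<omega>. X 0 \<omega> * Z 0 \<omega>) = expectation (\<lambda>\<omega>. x)"
    using x Z0 by (intro integral_cong_AE) (auto elim: AE_mp)
  then show "expectation (\<lambda>\<omega>. X T \<omega> * Z T \<omega>) \<le> x"
    using supermartingale_expectation_decreasing[OF sm] by (simp add: prob_space)
qed

lemma density_terminal_bound:
  assumes "Z \<in> supermartingale_densities M I F XX"
  shows "integrable M (Z T)" "expectation (Z T) \<le> 1"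
  using deflated_terminal_bound[OF assms one, of 1] by auto

text \<open>
  Where \<open>Z\<^sub>T \<ge> \<epsilon>\<close>, a payoff \<open>X\<^sub>T \<ge> 1\<close> forces \<open>X\<^sub>T Z\<^sub>T \<ge> \<epsilon>\<close>, and Markov's inequality limits how often
  this happens because the deflated payoff has mean at most the initial capital \<open>x\<close>.
\<close>

lemma prob_payoff_le:
  assumes Z: "Z \<in> supermartingale_densities M I F XX"
    and X: "X \<in> XX" and x: "AE \<omega> in M. X 0 \<omega> = x" and e: "0 < e"
  shows "prob {\<omega> \<in> space M. 1 \<le> X T \<omega>} \<le> prob {\<omega> \<in> space M. Z T \<omega> < e} + x / e"
proof -
  have [measurable]: "X T \<in> borel_measurable M" "Z T \<in> borel_measurable M"
    using adapted_terminal_measurable adapted[OF X] density_terminal_bound(1)[OF Z] by auto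
  let ?A = "{\<omega> \<in> space M. Z T \<omega> < e}" and ?B = "{\<omega> \<in> space M. X T \<omega> * Z T \<omega> \<ge> e}"
  have "\<omega> \<in> ?A \<union> ?B" if "\<omega> \<in> space M" "1 \<le> X T \<omega>" for \<omega>
    using that e mult_mono[of 1 "X T \<omega>" e "Z T \<omega>"] by (cases "Z T \<omega> < e") auto
  then have "prob {\<omega> \<in> space M. 1 \<le> X T \<omega>} \<le> prob (?A \<union> ?B)"
    by (intro finite_measure_mono) auto
  also have "\<dots> \<le> prob ?A + prob ?B"
    by (intro measure_Un_le) auto
  also have "prob ?B \<le> expectation (\<lambda>\<omega>. X T \<omega> * Z T \<omega>) / e"
  proof (rule integral_Markov_inequality_measure[where A = "space M"])
    show "AE \<omega> in M. 0 \<le> X T \<omega> * Z T \<omega>"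
      using nonneg[OF X, unfolded nonneg_process_def] density_strictly_pos_terminal[OF Z]
      by eventually_elim (use terminal_in_times in auto)
  qed (use deflated_terminal_bound[OF Z X x] e in auto)
  also have "\<dots> \<le> x / e"
    using deflated_terminal_bound(2)[OF Z X x] e by (intro divide_right_mono) auto
  finally show ?thesis by simp
qed

lemma inverse_numeraire_density:
  assumes "numeraire_portfolio M I F XX V"
  shows "(\<lambda>t \<omega>. 1 / V t \<omega>) \<in> supermartingale_densities M I F XX"
proof -
  have V: "V \<in> XX" "AE \<omega> in M. V 0 \<omega> = 1" "strictly_pos_process M I V"
    and sm: "\<And>X. X \<in> XX \<Longrightarrow> supermartingale M I F (\<lambda>t \<omega>. X t \<omega> / V t \<omega>)"
    using assms unfolding numeraire_portfolio_def unit_start_def by auto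
  show ?thesis
    unfolding supermartingale_densities_def
  proof (intro CollectI conjI ballI)
    show "adapted I F (\<lambda>t \<omega>. 1 / V t \<omega>)"
      using sm[OF one] unfolding supermartingale_def by auto
    show "strictly_pos_process M I (\<lambda>t \<omega>. 1 / V t \<omega>)"
      using V(3) unfolding strictly_pos_process_def by simp
    show "AE \<omega> in M. 1 / V 0 \<omega> = 1"
      using V(2) by eventually_elim auto
    show "supermartingale M I F (\<lambda>t \<omega>. X t \<omega> * (1 / V t \<omega>))" if "X \<in> XX" for X
      using sm[OF that] by simp
  qed
qed

end

section \<open>Asymptotic arbitrage\<close>

text \<open>
  The level \<open>\<epsilon>\<close> below which \<open>Z\<^sup>n\<^sub>T\<close> is rarely found does not depend on \<open>n\<close>, so the Markov term
  \<open>x\<^sub>n / \<epsilon>\<close> vanishes with the initial capital.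
\<close>

lemma asymptotically_positive_density_imp_NAA:
  fixes M :: "nat \<Rightarrow> 'a measure"
  assumes market: "\<And>n. n \<ge> 1 \<Longrightarrow> market (M n) (T n) (I n) (F n) (XX n)"
    and Z: "\<And>n. n \<ge> 1 \<Longrightarrow> Z n \<in> supermartingale_densities (M n) (I n) (F n) (XX n)"
    and tight: "asymptotically_positive M (\<lambda>n. Z n (T n))"
  shows "NAA M T XX"
  unfolding NAA_def
proof (intro allI impI)
  fix X :: "nat \<Rightarrow> 'a process" and x :: "nat \<Rightarrow> real"
  assume X: "\<forall>n\<ge>1. X n \<in> XX n \<and> (AE \<omega> in M n. X n 0 \<omega> = x n)" and x: "x \<longlonglongrightarrow> 0"
  let ?p = "\<lambda>n. measure (M n) {\<omega> \<in> space (M n). 1 \<le> X n (T n) \<omega>}"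
  have "?p \<longlonglongrightarrow> 0"
  proof (rule order_tendstoI)
    show "\<forall>\<^sub>F n in sequentially. y < ?p n" if "y < 0" for y
      using that by (intro always_eventually allI) (auto intro: less_le_trans)
    show "\<forall>\<^sub>F n in sequentially. ?p n < d" if d: "0 < d" for d
    proof -
      obtain e where e: "0 < e"
        and ev: "\<forall>\<^sub>F n in sequentially. measure (M n) {\<omega> \<in> space (M n). Z n (T n) \<omega> < e} \<le> d/2"
        using tight d unfolding asymptotically_positive_def by (meson half_gt_zero)
      have "\<forall>\<^sub>F n in sequentially. x n < d/2 * e"
        using order_tendstoD(2)[OF x, of "d/2 * e"] d e by simp
      with ev eventually_ge_at_top[of 1] show ?thesis
      proof eventually_elim
        case (elim n)
        have "x n / e < d/2"
          using elim e by (simp add: field_simps)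
        moreover have "?p n \<le> measure (M n) {\<omega> \<in> space (M n). Z n (T n) \<omega> < e} + x n / e"
          using X elim by (intro market.prob_payoff_le[OF market Z _ _ e]) auto
        ultimately show ?case
          using elim by linarith
      qed
    qed
  qed
  then have "(\<lambda>n. ereal (?p n)) \<longlonglongrightarrow> 0"
    by (simp add: zero_ereal_def)
  then show "limsup (\<lambda>n. ereal (?p n)) = 0"
    by (intro lim_imp_Limsup) auto
qed

text \<open>
  The level \<open>m n\<close> is raised by one each time \<open>P\<close> holds at the current level.  It cannot stall,
  since \<open>P\<close> holds infinitely often at every fixed level.  Unlike a level chosen along a subsequence, it is
  defined, and tends to infinity, along all of \<open>n\<close>, as is required of the initial capitals of an
  asymptotic arbitrage.
\<close>

lemma levels_tending_to_infinity:
  fixes P :: "nat \<Rightarrow> nat \<Rightarrow> bool"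
  assumes "\<And>k. \<exists>\<^sub>F n in sequentially. P k n"
  obtains m where "filterlim m at_top sequentially" "\<exists>\<^sub>F n in sequentially. P (m n) n"
proof -
  define m where "m = rec_nat 0 (\<lambda>n k. if P k n then Suc k else k)"
  have m_Suc: "m (Suc n) = (if P (m n) n then Suc (m n) else m n)" for n
    by (simp add: m_def)
  have mono: "mono m"
    by (intro incseq_SucI) (simp add: m_Suc)
  have hit: "\<exists>n\<ge>N. P (m n) n" for N
  proof (rule ccontr)
    assume none: "\<not> (\<exists>n\<ge>N. P (m n) n)"
    have "m n = m N" if "n \<ge> N" for n
      using that by (induction rule: dec_induct) (use none m_Suc in auto)
    moreover obtain n where "n \<ge> N" "P (m N) n"
      using assms[of "m N"] by (auto simp: frequently_sequentially)
    ultimately show False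
      using none by metis
  qed
  have unbounded: "\<exists>n. k \<le> m n" for k
  proof (induction k)
    case (Suc k)
    then obtain N where "k \<le> m N" by blast
    moreover obtain n where "n \<ge> N" "P (m n) n"
      using hit by blast
    ultimately have "Suc k \<le> m (Suc n)"
      using monoD[OF mono, of N n] m_Suc by auto
    then show ?case by blast
  qed simp
  show thesis
  proof
    show "filterlim m at_top sequentially"
      unfolding filterlim_at_top eventually_sequentially
      using unbounded monoD[OF mono] by (meson order_trans)
    show "\<exists>\<^sub>F n in sequentially. P (m n) n"
      using hit by (auto simp: frequently_sequentially)
  qed
qed

text \<open>
  If \<open>P\<^sup>n(V\<^sup>n\<^sub>T > k) > \<delta>\<close> for infinitely many \<open>n\<close>, whatever the level \<open>k\<close>, then dividing \<open>V\<^sup>n\<close> by levels that grow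
  slowly enough costs a vanishing initial capital and still pays at least one with
  probability above \<open>\<delta>\<close> for infinitely many \<open>n\<close>.
\<close>

lemma NAA_imp_inverse_numeraire_asymptotically_positive:
  fixes M :: "nat \<Rightarrow> 'a measure"
  assumes market: "\<And>n. n \<ge> 1 \<Longrightarrow> market (M n) (T n) (I n) (F n) (XX n)"
    and V: "\<And>n. n \<ge> 1 \<Longrightarrow> numeraire_portfolio (M n) (I n) (F n) (XX n) (V n)"
    and NAA: "NAA M T XX"
  shows "asymptotically_positive M (\<lambda>n \<omega>. 1 / V n (T n) \<omega>)"
proof (rule ccontr)
  assume "\<not> ?thesis"
  then obtain d where d: "0 < d" and no_bound: "\<forall>e>0. \<not> (\<forall>\<^sub>F n in sequentially.
      measure (M n) {\<omega> \<in> space (M n). 1 / V n (T n) \<omega> < e} \<le> d)"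
    unfolding asymptotically_positive_def by blast
  have not_tight:
    "\<exists>\<^sub>F n in sequentially. d < measure (M n) {\<omega> \<in> space (M n). 1 / V n (T n) \<omega> < e}"
    if "0 < e" for e
    using no_bound that by (simp add: not_eventually not_le)
  obtain m where m: "filterlim m at_top sequentially"
    and hit: "\<exists>\<^sub>F n in sequentially.
      d < measure (M n) {\<omega> \<in> space (M n). 1 / V n (T n) \<omega> < 1 / real (Suc (m n))}"
    by (rule levels_tending_to_infinity[of
          "\<lambda>k n. d < measure (M n) {\<omega> \<in> space (M n). 1 / V n (T n) \<omega> < 1 / real (Suc k)}"])
      (auto intro: not_tight)
  define x where "x n = 1 / real (Suc (m n))" for n
  define X where "X n = (\<lambda>t \<omega>. x n * V n t \<omega>)" for n
  have x_pos: "0 < x n" for n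
    by (simp add: x_def)
  have V': "V n \<in> XX n" "AE \<omega> in M n. V n 0 \<omega> = 1" "strictly_pos_process (M n) (I n) (V n)"
    if "n \<ge> 1" for n
    using V[OF that] unfolding numeraire_portfolio_def unit_start_def by auto
  have "x \<longlonglongrightarrow> 0"
    unfolding x_def using LIMSEQ_inverse_real_of_nat m
    by (auto intro: filterlim_compose simp: inverse_eq_divide)
  moreover have "X n \<in> XX n \<and> (AE \<omega> in M n. X n 0 \<omega> = x n)" if "n \<ge> 1" for n
  proof
    show "X n \<in> XX n"
      unfolding X_def using market.scale[OF market V'(1)] that x_pos by auto
    show "AE \<omega> in M n. X n 0 \<omega> = x n"
      using V'(2)[OF that] by eventually_elim (simp add: X_def)
  qed
  ultimately have "limsup (\<lambda>n. ereal (measure (M n) {\<omega> \<in> space (M n). 1 \<le> X n (T n) \<omega>})) = 0"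
    using NAA unfolding NAA_def by blast
  then have "limsup (\<lambda>n. ereal (measure (M n) {\<omega> \<in> space (M n). 1 \<le> X n (T n) \<omega>})) < ereal d"
    using d by simp
  then have "\<forall>\<^sub>F n in sequentially. measure (M n) {\<omega> \<in> space (M n). 1 \<le> X n (T n) \<omega>} < d"
    by (auto dest: Limsup_lessD)
  then have "\<forall>\<^sub>F n in sequentially.
      \<not> d < measure (M n) {\<omega> \<in> space (M n). 1 / V n (T n) \<omega> < 1 / real (Suc (m n))}"
    using eventually_ge_at_top[of 1]
  proof eventually_elim
    case (elim n)
    interpret market "M n" "T n" "I n" "F n" "XX n"
      using market elim by simp
    have [measurable]: "V n (T n) \<in> borel_measurable (M n)"
      using adapted_terminal_measurable adapted V'(1) elim by blast
    have "AE \<omega> in M n. 0 < V n (T n) \<omega>"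
      using V'(3)[OF \<open>n \<ge> 1\<close>, unfolded strictly_pos_process_def]
      by eventually_elim (use terminal_in_times in auto)
    then have "measure (M n) {\<omega> \<in> space (M n). 1 / V n (T n) \<omega> < x n}
        \<le> measure (M n) {\<omega> \<in> space (M n). 1 \<le> X n (T n) \<omega>}"
      unfolding X_def using x_pos[of n]
      by (intro finite_measure_mono_AE) (auto elim!: AE_mp simp: field_simps)
    then show ?case
      using elim unfolding x_def by simp
  qed
  then show False
    using hit by (simp add: frequently_def)
qed

section \<open>The equivalence\<close>

theorem theorem2p7:
  fixes M :: "nat \<Rightarrow> 'a measure" and T :: "nat \<Rightarrow> real" and I :: "nat \<Rightarrow> real set"
    and F :: "nat \<Rightarrow> real \<Rightarrow> 'a measure" and XX :: "nat \<Rightarrow> 'a process set"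
    and V :: "nat \<Rightarrow> 'a process"
  assumes "\<And>n. n \<ge> 1 \<Longrightarrow> market (M n) (T n) (I n) (F n) (XX n)"
    and "\<And>n. n \<ge> 1 \<Longrightarrow> numeraire_portfolio (M n) (I n) (F n) (XX n) (V n)"
  shows "(NAA M T XX \<longleftrightarrow>
           ((\<lambda>\<alpha>. liminf (\<lambda>n. \<integral>\<^sup>+ \<omega>. ennreal (V n (T n) \<omega> powr (- \<alpha>)) \<partial>M n)) \<longlongrightarrow> 1) (at_right 0))
       \<and> (NAA M T XX \<longleftrightarrow>
           (\<exists>Z. (\<forall>n\<ge>1. Z n \<in> supermartingale_densities (M n) (I n) (F n) (XX n)) \<and>
             ((\<lambda>\<alpha>. liminf (\<lambda>n. \<integral>\<^sup>+ \<omega>. ennreal (Z n (T n) \<omega> powr \<alpha>) \<partial>M n)) \<longlongrightarrow> 1) (at_right 0)))"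
proof -
  define is_density where "is_density Z \<longleftrightarrow>
    (\<forall>n\<ge>1. Z n \<in> supermartingale_densities (M n) (I n) (F n) (XX n))" for Z
  define moments where "moments Z \<longleftrightarrow>
    ((\<lambda>\<alpha>. liminf (\<lambda>n. \<integral>\<^sup>+ \<omega>. ennreal (Z n (T n) \<omega> powr \<alpha>) \<partial>M n)) \<longlongrightarrow> 1) (at_right 0)"
    for Z :: "nat \<Rightarrow> 'a process"
  define W where "W n = (\<lambda>t \<omega>. 1 / V n t \<omega>)" for n
  have prob: "prob_space (M n)" if "n \<ge> 1" for n
    using assms(1)[OF that] by (simp add: market_def filtered_prob_space_def)
  have moments_iff: "moments Z \<longleftrightarrow> asymptotically_positive M (\<lambda>n. Z n (T n))"
    if "is_density Z" for Z
    unfolding moments_def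
    by (rule moments_tendsto_one_iff_asymptotically_positive)
      (use that prob market.density_terminal_bound[OF assms(1)]
        market.density_strictly_pos_terminal[OF assms(1)] in \<open>auto simp: is_density_def\<close>)
  have W: "is_density W"
    unfolding is_density_def W_def
    using market.inverse_numeraire_density[OF assms(1) assms(2)] by blast
  have NAA_moments: "moments W" if "NAA M T XX"
    using moments_iff[OF W] NAA_imp_inverse_numeraire_asymptotically_positive[OF assms that]
    by (simp add: W_def)
  have moments_NAA: "NAA M T XX" if "is_density Z" "moments Z" for Z
  proof (rule asymptotically_positive_density_imp_NAA[OF assms(1)])
    show "Z n \<in> supermartingale_densities (M n) (I n) (F n) (XX n)" if "n \<ge> 1" for n
      using \<open>is_density Z\<close> that by (simp add: is_density_def)
    show "asymptotically_positive M (\<lambda>n. Z n (T n))"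
      using moments_iff that by simp
  qed
  have "NAA M T XX \<longleftrightarrow> moments W" "NAA M T XX \<longleftrightarrow> (\<exists>Z. is_density Z \<and> moments Z)"
    using NAA_moments moments_NAA W by auto
  moreover have "(1 / v) powr \<alpha> = v powr - \<alpha>" for v \<alpha> :: real
    by (simp add: powr_minus divide_inverse inverse_powr)
  ultimately show ?thesis
    by (simp add: moments_def W_def is_density_def)
qed

end
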